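(* Let $\alpha\in\mathbb{R}$ and $\beta\ge 1$, and consider the boundary value problem $$u''(x)+\frac{\beta}{x}u'(x)=f(x,u(x)),\quad 0<x\le 1,\qquad u'(0)=0,\quad u(1)=\alpha .$$ Suppose that the function $f$ is continuous and that there exist constants $M>0$, $L\ge 0$ such that $$|f(x,u)|\le M,\qquad |f(x,u_2)-f(x,u_1)|\le L|u_2-u_1|$$ for all $(x,u),(x,u_1),(x,u_2)\in\mathcal{D}_M$, where $$\mathcal{D}_M=\Big\{(x,u)\ :\ 0\le x\le 1,\ |u|\le |\alpha|+\frac{M}{2(\beta+1)}\Big\},$$ and that $$q=\frac{L}{2(\beta+1)}<1 .$$ Then the boundary value problem admits a unique solution $u$, which satisfies the bounds $$\|u\|\le |\alpha|+\frac{M}{2(\beta+1)},\qquad \|u'\|\le\frac{M}{\beta+1}.$$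
   Context: $\|\cdot\|$ denotes the uniform (maximum) norm on $C[0,1]$. The function $f=f(x,u)$ is a real-valued function of $x\in[0,1]$ and $u\in\mathbb{R}$. A solution is a function that is continuously differentiable on $[0,1]$, twice differentiable on $(0,1]$, and satisfies the differential equation on $(0,1]$ and the two boundary conditions.
   Formalization: Uniqueness is stated only among solutions v with ‖v‖ ≤ |α|+M/(2(β+1)); uniqueness among all solutions is false, e.g. α=0, L=0, f(x,u)=-C·max(u-M/(2(β+1)),0) with C large has u=0 and a second solution. *)

theory Defs
  imports "HOL-Analysis.Analysis"
begin

text \<open>Derivative relative to the interval [0,1], hence one-sided at 0 and at 1. It is the
  derivative only where the function is differentiable; differentiability is always required
  separately.\<close>

definition deriv01 :: "(real \<Rightarrow> real) \<Rightarrow> real \<Rightarrow> real" where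
  "deriv01 u x = vector_derivative u (at x within {0..1})"

text \<open>The supremum of an unbounded set of reals is unspecified, so this is the uniform norm
  only for functions bounded on [0,1], in particular for those continuous there.\<close>

definition unorm :: "(real \<Rightarrow> real) \<Rightarrow> real" where
  "unorm g = (SUP x\<in>{0..1}. \<bar>g x\<bar>)"

definition D_dom :: "real \<Rightarrow> real \<Rightarrow> real \<Rightarrow> (real \<times> real) set" where
  "D_dom \<alpha> \<beta> M = {(x, u). 0 \<le> x \<and> x \<le> 1 \<and> \<bar>u\<bar> \<le> \<bar>\<alpha>\<bar> + M / (2 * (\<beta> + 1))}"

definition bvp_solution ::
  "real \<Rightarrow> real \<Rightarrow> (real \<Rightarrow> real \<Rightarrow> real) \<Rightarrow> (real \<Rightarrow> real) \<Rightarrow> bool" where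
  "bvp_solution \<alpha> \<beta> f u \<longleftrightarrow>
     (\<forall>x\<in>{0..1}. u differentiable (at x within {0..1})) \<and>
     continuous_on {0..1} (deriv01 u) \<and>
     (\<forall>x\<in>{0<..1}. deriv01 u differentiable (at x within {0..1})) \<and>
     (\<forall>x\<in>{0<..1}. deriv01 (deriv01 u) x + \<beta> / x * deriv01 u x = f x (u x)) \<and>
     deriv01 u 0 = 0 \<and> u 1 = \<alpha>"

end

theory Submission
  imports Defs
begin

text \<open>Fix a continuous right-hand side \<open>g\<close>. Since
  \<open>(x\<^sup>\<beta> u')' = x\<^sup>\<beta> (u'' + (\<beta> / x) u')\<close>, the linear problem \<open>u'' + (\<beta> / x) u' = g\<close>,
  \<open>u'(0) = 0\<close>, \<open>u(1) = \<alpha>\<close> is solved by two integrations, \<open>x\<^sup>\<beta> u'(x) = \<integral>\<^sub>0\<^sup>x t\<^sup>\<beta> g(t) dt\<close>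
  followed by \<open>u(x) = \<alpha> - \<integral>\<^sub>x\<^sup>1 u'(t) dt\<close> (\<open>linear_bvp_exists\<close>).

  Comparing with the solution for a constant right-hand side \<open>K\<close>, whose derivative is
  \<open>K x / (\<beta> + 1)\<close>, shows that \<open>\<bar>g\<bar> \<le> K\<close> forces \<open>\<bar>u'\<bar> \<le> K / (\<beta> + 1)\<close> and
  \<open>\<bar>u - \<alpha>\<bar> \<le> K / (2 (\<beta> + 1))\<close> (\<open>linear_bvp_bounds\<close>). This one estimate is used three times.
  With \<open>K = M\<close> it shows that the map sending \<open>\<phi>\<close> to the solution for
  \<open>g(x) = f(x, \<phi>(x))\<close> preserves the ball of radius \<open>\<bar>\<alpha>\<bar> + M / (2 (\<beta> + 1))\<close>, and it yields the
  bound on \<open>u'\<close>. Applied to the difference of two solutions, with \<open>K = L \<parallel>\<phi> - \<psi>\<parallel>\<close>, it shows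
  that this map contracts by the factor \<open>q = L / (2 (\<beta> + 1)) < 1\<close>, so Banach's theorem gives a
  fixed point. Applied to the difference of two solutions of the nonlinear problem, it shows
  that the maximum of their distance is at most \<open>q\<close> times itself, hence zero.\<close>

section \<open>The linear problem\<close>

text \<open>The derivative \<open>w\<close> of \<open>u\<close> is carried along as a separate function: superposition
  and the estimates then speak of honest derivatives rather than of \<open>deriv01\<close>.\<close>

definition linear_bvp ::
  "real \<Rightarrow> real \<Rightarrow> (real \<Rightarrow> real) \<Rightarrow> (real \<Rightarrow> real) \<Rightarrow> (real \<Rightarrow> real) \<Rightarrow> bool" where
  "linear_bvp \<alpha> \<beta> g u w \<longleftrightarrow>
     (\<forall>x\<in>{0..1}. (u has_real_derivative w x) (at x within {0..1})) \<and>
     continuous_on {0..1} w \<and>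
     (\<forall>x\<in>{0<..1}. (w has_real_derivative (g x - \<beta> / x * w x)) (at x within {0..1})) \<and>
     w 0 = 0 \<and> u 1 = \<alpha>"

lemma deriv01_eq:
  assumes "(u has_real_derivative d) (at x within {0..1})" "x \<in> {0..1}"
  shows "deriv01 u x = d"
  unfolding deriv01_def
  using assms vector_derivative_within_closed_interval[of 0 1 x u d]
  by (simp add: has_real_derivative_iff_has_vector_derivative)

lemma has_real_derivative_deriv01:
  assumes "u differentiable (at x within {0..1})" "x \<in> {0..1}"
  shows "(u has_real_derivative deriv01 u x) (at x within {0..1})"
  using assms deriv01_eq by (metis real_differentiableE)

lemma linear_bvp_deriv01:
  assumes "linear_bvp \<alpha> \<beta> g u w" "x \<in> {0..1}"
  shows "deriv01 u x = w x"
  using assms deriv01_eq unfolding linear_bvp_def by blast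

lemma linear_bvp_continuous:
  assumes "linear_bvp \<alpha> \<beta> g u w"
  shows "continuous_on {0..1} u"
  using assms unfolding linear_bvp_def
  by (meson DERIV_continuous continuous_on_eq_continuous_within)

lemma linear_bvp_diff:
  assumes "linear_bvp \<alpha> \<beta> g u w" "linear_bvp \<alpha>' \<beta> h v z"
  shows "linear_bvp (\<alpha> - \<alpha>') \<beta> (\<lambda>x. g x - h x) (\<lambda>x. u x - v x) (\<lambda>x. w x - z x)"
  using assms unfolding linear_bvp_def
  by (auto intro!: derivative_eq_intros continuous_intros simp: algebra_simps)

lemma bvp_solution_imp_linear_bvp:
  assumes "bvp_solution \<alpha> \<beta> f u"
  shows "linear_bvp \<alpha> \<beta> (\<lambda>x. f x (u x)) u (deriv01 u)"
proof -
  have "(deriv01 u has_real_derivative (f x (u x) - \<beta> / x * deriv01 u x)) (at x within {0..1})"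
    if "x \<in> {0<..1}" for x
  proof -
    have "f x (u x) - \<beta> / x * deriv01 u x = deriv01 (deriv01 u) x"
      using assms that unfolding bvp_solution_def by (smt (verit, best))
    then show ?thesis
      using assms that has_real_derivative_deriv01 unfolding bvp_solution_def by auto
  qed
  then show ?thesis
    using assms has_real_derivative_deriv01 unfolding bvp_solution_def linear_bvp_def by auto
qed

lemma linear_bvp_imp_bvp_solution:
  assumes lin: "linear_bvp \<alpha> \<beta> (\<lambda>x. f x (u x)) u w"
  shows "bvp_solution \<alpha> \<beta> f u"
proof -
  have eq: "deriv01 u x = w x" if "x \<in> {0..1}" for x
    using linear_bvp_deriv01[OF lin that] .
  have D: "(deriv01 u has_real_derivative (f x (u x) - \<beta> / x * deriv01 u x)) (at x within {0..1})"
    if "x \<in> {0<..1}" for x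
  proof (rule has_field_derivative_transform_within)
    show "(w has_real_derivative (f x (u x) - \<beta> / x * deriv01 u x)) (at x within {0..1})"
      using lin that eq[of x] unfolding linear_bvp_def by auto
  qed (use that eq in auto)
  have "continuous_on {0..1} (deriv01 u)"
    using lin eq unfolding linear_bvp_def by (metis continuous_on_cong)
  moreover have "deriv01 (deriv01 u) x + \<beta> / x * deriv01 u x = f x (u x)"
    if "x \<in> {0<..1}" for x
    using deriv01_eq[OF D[OF that]] that by auto
  moreover have "deriv01 u differentiable (at x within {0..1})" if "x \<in> {0<..1}" for x
    using D[OF that] real_differentiable_def by blast
  moreover have "u differentiable (at x within {0..1})" if "x \<in> {0..1}" for x
    using lin that real_differentiable_def unfolding linear_bvp_def by blast
  ultimately show ?thesis
    using lin eq[of 0] unfolding bvp_solution_def linear_bvp_def by auto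
qed

section \<open>A priori estimates\<close>

text \<open>The functions \<open>\<plusminus>H\<close> grow no faster than the comparison function, so the
  difference is monotone. Derivatives are asked for only inside the interval:
  one of the functions \<open>H\<close> of interest is \<open>x\<^sup>\<beta> u'(x)\<close>, and at \<open>0\<close> the factor \<open>u'\<close> is
  merely known to be continuous.\<close>

lemma weighted_growth_bound:
  assumes \<beta>: "\<beta> > 0"
    and H: "continuous_on {0..1} H" "H 0 = 0"
    and dH: "\<And>x. 0 < x \<Longrightarrow> x < 1 \<Longrightarrow> (H has_real_derivative x powr \<beta> * g x) (at x)"
    and g: "\<And>x. 0 < x \<Longrightarrow> x < 1 \<Longrightarrow> \<bar>g x\<bar> \<le> K"
    and x: "x \<in> {0..1}"
  shows "\<bar>H x\<bar> \<le> K * x powr (\<beta> + 1) / (\<beta> + 1)"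
proof -
  define c where "c = K / (\<beta> + 1)"
  have K: "K = c * (\<beta> + 1)" using \<beta> by (simp add: c_def)
  have bound: "s * H x \<le> c * x powr (\<beta> + 1)" if s: "\<bar>s\<bar> = 1" for s :: real
  proof -
    let ?E = "\<lambda>t. c * t powr (\<beta> + 1) - s * H t"
    have "?E 0 \<le> ?E x"
    proof (rule DERIV_nonneg_imp_increasing_open[where f = ?E])
      fix t assume t: "0 < t" "t < x"
      have "s * g t \<le> \<bar>s * g t\<bar>" by simp
      also have "\<dots> \<le> K" using g[of t] t x s by (simp add: abs_mult)
      finally have "0 \<le> t powr \<beta> * (K - s * g t)" by simp
      moreover have "(?E has_real_derivative t powr \<beta> * (K - s * g t)) (at t)"
        using t x \<beta>
        by (auto intro!: derivative_eq_intros dH simp: K algebra_simps)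
      ultimately show "\<exists>y. (?E has_real_derivative y) (at t) \<and> 0 \<le> y" by blast
    next
      show "continuous_on {0..x} ?E"
        using \<beta> x by (auto intro!: continuous_intros continuous_on_powr' continuous_on_subset[OF H(1)])
    qed (use x in auto)
    then show ?thesis using H(2) by simp
  qed
  show ?thesis using bound[of 1] bound[of "-1"] by (simp add: c_def)
qed

text \<open>The quantity \<open>x\<^sup>\<beta> w\<close> has derivative \<open>x\<^sup>\<beta> g\<close>: the singular term is absorbed by the
  integrating factor. The bound on \<open>w\<close> is then integrated from \<open>x\<close> to \<open>1\<close>, which produces the
  factor \<open>(1 - x\<^sup>2) / 2\<close>.\<close>

lemma linear_bvp_bounds:
  assumes \<beta>: "\<beta> > 0" and lin: "linear_bvp \<alpha> \<beta> g u w"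
    and g: "\<And>x. x \<in> {0..1} \<Longrightarrow> \<bar>g x\<bar> \<le> K"
    and x: "x \<in> {0..1}"
  shows linear_bvp_derivative_bound: "\<bar>w x\<bar> \<le> K * x / (\<beta> + 1)"
    and linear_bvp_value_bound: "\<bar>u x - \<alpha>\<bar> \<le> K * (1 - x\<^sup>2) / (2 * (\<beta> + 1))"
proof -
  have du: "(u has_real_derivative w t) (at t)" if "0 < t" "t < 1" for t
    using lin that unfolding linear_bvp_def
    by (metis at_within_Icc_at atLeastAtMost_iff greaterThanAtMost_iff less_imp_le)
  have dw: "(w has_real_derivative (g t - \<beta> / t * w t)) (at t)" if "0 < t" "t < 1" for t
    using lin that unfolding linear_bvp_def
    by (metis at_within_Icc_at atLeastAtMost_iff greaterThanAtMost_iff less_imp_le)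
  have w: "\<bar>w t\<bar> \<le> K * t / (\<beta> + 1)" if t: "t \<in> {0..1}" for t
  proof (cases "t = 0")
    case True
    then show ?thesis using lin unfolding linear_bvp_def by simp
  next
    case False
    have "\<bar>t powr \<beta> * w t\<bar> \<le> K * t powr (\<beta> + 1) / (\<beta> + 1)"
    proof (rule weighted_growth_bound[OF \<beta>])
      show "continuous_on {0..1} (\<lambda>t. t powr \<beta> * w t)"
        using \<beta> lin unfolding linear_bvp_def
        by (auto intro!: continuous_intros continuous_on_powr')
      show "((\<lambda>t. t powr \<beta> * w t) has_real_derivative t powr \<beta> * g t) (at t)"
        if "0 < t" "t < 1" for t
        using that
        by (auto intro!: derivative_eq_intros dw simp: powr_diff field_simps)
    qed (use g t in auto)
    also have "\<dots> = t powr \<beta> * (K * t / (\<beta> + 1))"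
      using t False by (simp add: powr_add)
    finally show ?thesis
      using t False mult_le_cancel_left_pos[of "t powr \<beta>" "\<bar>w t\<bar>" "K * t / (\<beta> + 1)"]
      by (simp add: abs_mult)
  qed
  then show "\<bar>w x\<bar> \<le> K * x / (\<beta> + 1)" using x by blast
  define c where "c = K / (\<beta> + 1)"
  have bound: "s * (u x - \<alpha>) \<le> c * (1 - x\<^sup>2) / 2" if s: "\<bar>s\<bar> = 1" for s :: real
  proof -
    let ?E = "\<lambda>t. s * u t + c * t\<^sup>2 / 2"
    have "?E x \<le> ?E 1"
    proof (rule DERIV_nonneg_imp_increasing_open[where f = ?E])
      fix t assume t: "x < t" "t < 1"
      have "- (s * w t) \<le> \<bar>s * w t\<bar>" by simp
      also have "\<dots> \<le> c * t" using w[of t] t x s by (simp add: abs_mult c_def)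
      finally have "0 \<le> s * w t + c * t" by simp
      moreover have "(?E has_real_derivative s * w t + c * t) (at t)"
        using t x by (auto intro!: derivative_eq_intros du)
      ultimately show "\<exists>y. (?E has_real_derivative y) (at t) \<and> 0 \<le> y" by blast
    next
      show "continuous_on {x..1} ?E"
        using x
        by (auto intro!: continuous_intros continuous_on_subset[OF linear_bvp_continuous[OF lin]])
    qed (use x in auto)
    moreover have "u 1 = \<alpha>" using lin unfolding linear_bvp_def by simp
    ultimately show ?thesis by (simp add: algebra_simps diff_divide_distrib)
  qed
  have "\<bar>u x - \<alpha>\<bar> \<le> c * (1 - x\<^sup>2) / 2"
    by (rule abs_leI) (use bound[of 1] bound[of "-1"] in auto)
  moreover have "c * (1 - x\<^sup>2) / 2 = K * (1 - x\<^sup>2) / (2 * (\<beta> + 1))"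
    by (simp add: c_def)
  ultimately show "\<bar>u x - \<alpha>\<bar> \<le> K * (1 - x\<^sup>2) / (2 * (\<beta> + 1))"
    by simp
qed

corollary linear_bvp_value_bound':
  assumes "\<beta> > 0" "linear_bvp \<alpha> \<beta> g u w"
    and g: "\<And>x. x \<in> {0..1} \<Longrightarrow> \<bar>g x\<bar> \<le> K"
    and x: "x \<in> {0..1}"
  shows "\<bar>u x - \<alpha>\<bar> \<le> K / (2 * (\<beta> + 1))"
proof -
  have "0 \<le> K" using g[of 0] by simp
  then have "K * (1 - x\<^sup>2) \<le> K" by (simp add: mult_left_le)
  then have "K * (1 - x\<^sup>2) / (2 * (\<beta> + 1)) \<le> K / (2 * (\<beta> + 1))"
    using assms(1) by (simp add: divide_right_mono)
  then show ?thesis using linear_bvp_value_bound[OF assms] by linarith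
qed

section \<open>Solving the linear problem\<close>

text \<open>Off \<open>0\<close> the quotient \<open>w = x\<^sup>-\<^sup>\<beta> \<integral>\<^sub>0\<^sup>x t\<^sup>\<beta> g(t) dt\<close> is smooth enough by the fundamental
  theorem; at \<open>0\<close> its continuity comes from the growth bound, which gives
  \<open>w(x) = O(x)\<close>.\<close>

lemma linear_bvp_exists:
  assumes \<beta>: "\<beta> > 0" and g: "continuous_on {0..1} g"
  shows "\<exists>u w. linear_bvp \<alpha> \<beta> g u w"
proof -
  define H where "H = (\<lambda>x. integral {0..x} (\<lambda>t. t powr \<beta> * g t))"
  \<comment> \<open>At \<open>0\<close> this is \<open>0\<close>, since \<open>0 powr a = 0\<close> also for negative \<open>a\<close>.\<close>
  define w where "w = (\<lambda>x. x powr (- \<beta>) * H x)"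
  define u where "u = (\<lambda>x. \<alpha> + (integral {0..x} w - integral {0..1} w))"
  have "continuous_on {0..1} (\<lambda>t. t powr \<beta> * g t)"
    using \<beta> by (auto intro!: continuous_intros continuous_on_powr' g)
  then have dH: "(H has_real_derivative x powr \<beta> * g x) (at x within {0..1})"
    if "x \<in> {0..1}" for x
    unfolding H_def using integral_has_real_derivative that by blast
  have dH': "(H has_real_derivative x powr \<beta> * g x) (at x)" if "0 < x" "x < 1" for x
    using dH[of x] that at_within_Icc_at[of 0 x 1] by simp
  have contH: "continuous_on {0..1} H"
    using dH by (meson DERIV_continuous continuous_on_eq_continuous_within)
  have dw: "(w has_real_derivative (g x - \<beta> / x * w x)) (at x within {0..1})"
    if "x \<in> {0<..1}" for x
    unfolding w_def using that
    by (auto intro!: derivative_eq_intros dH simp: powr_diff powr_minus field_simps)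
  obtain K where K: "\<And>x. x \<in> {0..1} \<Longrightarrow> \<bar>g x\<bar> \<le> K"
    using compact_imp_bounded[OF compact_continuous_image[OF g compact_Icc]]
    unfolding bounded_iff by (metis imageI real_norm_def)
  have wx: "\<bar>w x\<bar> \<le> K / (\<beta> + 1) * \<bar>x\<bar>" if x: "x \<in> {0..1}" for x
  proof (cases "x = 0")
    case False
    have "\<bar>H x\<bar> \<le> K * x powr (\<beta> + 1) / (\<beta> + 1)"
      by (rule weighted_growth_bound[OF \<beta> contH _ dH']) (use K x in \<open>auto simp: H_def\<close>)
    then have "x powr (- \<beta>) * \<bar>H x\<bar> \<le> x powr (- \<beta>) * (K * x powr (\<beta> + 1) / (\<beta> + 1))"
      by (rule mult_left_mono) simp
    also have "\<dots> = K / (\<beta> + 1) * \<bar>x\<bar>"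
      using x False powr_add[of x "- \<beta>" "\<beta> + 1"] by (simp add: mult.left_commute)
    finally show ?thesis by (simp add: w_def abs_mult)
  qed (simp add: w_def)
  have w0: "w 0 = 0" by (simp add: w_def)
  have "(w \<longlongrightarrow> 0) (at 0 within {0..1})"
  proof (rule Lim_null_comparison)
    show "\<forall>\<^sub>F x in at 0 within {0..1}. norm (w x) \<le> K / (\<beta> + 1) * \<bar>x\<bar>"
      using wx by (auto simp: eventually_at_filter)
    show "((\<lambda>x. K / (\<beta> + 1) * \<bar>x\<bar>) \<longlongrightarrow> 0) (at 0 within {0..1})"
      using tendsto_mult_right_zero[OF tendsto_rabs_zero[OF tendsto_ident_at]] .
  qed
  then have "(w \<longlongrightarrow> w x) (at x within {0..1})" if "x \<in> {0..1}" for x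
    using that w0 DERIV_continuous[OF dw[of x]] by (cases "x = 0") (auto simp: continuous_within)
  then have contw: "continuous_on {0..1} w"
    by (simp add: continuous_on_def)
  have "(u has_real_derivative w x) (at x within {0..1})" if "x \<in> {0..1}" for x
    unfolding u_def
    by (auto intro!: derivative_eq_intros integral_has_real_derivative contw that)
  moreover have "u 1 = \<alpha>" by (simp add: u_def)
  ultimately show ?thesis
    using dw contw w0 unfolding linear_bvp_def by blast
qed

section \<open>The nonlinear problem\<close>

lemma abs_le_unorm:
  assumes "continuous_on {0..1} u" "x \<in> {0..1}"
  shows "\<bar>u x\<bar> \<le> unorm u"
  unfolding unorm_def
proof (rule cSUP_upper)
  have "continuous_on {0..1} (\<lambda>x. \<bar>u x\<bar>)" using assms by (intro continuous_intros)
  then show "bdd_above ((\<lambda>x. \<bar>u x\<bar>) ` {0..1})"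
    by (intro bounded_imp_bdd_above compact_imp_bounded compact_continuous_image) auto
qed (rule assms)

lemma unorm_le:
  assumes "\<And>x. x \<in> {0..1} \<Longrightarrow> \<bar>u x\<bar> \<le> B"
  shows "unorm u \<le> B"
  unfolding unorm_def by (rule cSUP_least) (use assms in auto)

text \<open>At a point where \<open>\<bar>u - v\<bar>\<close> is largest, the estimate for the difference bounds this
  maximum by \<open>L / (2 (\<beta> + 1))\<close> times itself.\<close>

lemma bvp_solution_unique_in_ball:
  assumes \<beta>: "\<beta> > 0" and L: "L \<ge> 0" "L / (2 * (\<beta> + 1)) < 1"
    and lip: "\<And>x a b. x \<in> {0..1} \<Longrightarrow> \<bar>a\<bar> \<le> R \<Longrightarrow> \<bar>b\<bar> \<le> R \<Longrightarrow> \<bar>f x b - f x a\<bar> \<le> L * \<bar>b - a\<bar>"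
    and u: "linear_bvp \<alpha> \<beta> (\<lambda>x. f x (u x)) u w" "\<And>x. x \<in> {0..1} \<Longrightarrow> \<bar>u x\<bar> \<le> R"
    and v: "linear_bvp \<alpha> \<beta> (\<lambda>x. f x (v x)) v z" "\<And>x. x \<in> {0..1} \<Longrightarrow> \<bar>v x\<bar> \<le> R"
    and x: "x \<in> {0..1}"
  shows "v x = u x"
proof -
  have "continuous_on {0..1} (\<lambda>x. \<bar>v x - u x\<bar>)"
    using u(1) v(1) linear_bvp_continuous by (auto intro!: continuous_intros)
  then obtain y where y: "y \<in> {0..1}" and max: "\<And>t. t \<in> {0..1} \<Longrightarrow> \<bar>v t - u t\<bar> \<le> \<bar>v y - u y\<bar>"
    using continuous_attains_sup[of "{0..1}" "\<lambda>x. \<bar>v x - u x\<bar>"] by auto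
  have rhs: "\<bar>f t (v t) - f t (u t)\<bar> \<le> L * \<bar>v y - u y\<bar>" if "t \<in> {0..1}" for t
    using lip[OF that u(2)[OF that] v(2)[OF that]] mult_left_mono[OF max[OF that] L(1)]
    by linarith
  have "\<bar>(v y - u y) - (\<alpha> - \<alpha>)\<bar> \<le> L * \<bar>v y - u y\<bar> / (2 * (\<beta> + 1))"
    by (rule linear_bvp_value_bound'[OF \<beta> linear_bvp_diff[OF v(1) u(1)] rhs y])
  then have "(1 - L / (2 * (\<beta> + 1))) * \<bar>v y - u y\<bar> \<le> 0"
    by (simp add: algebra_simps)
  then have "\<bar>v y - u y\<bar> \<le> 0" using L(2) by (simp add: mult_le_0_iff)
  then show ?thesis using max[OF x] by simp
qed

text \<open>Banach's fixed point theorem is applied in the complete space of bounded continuous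
  functions on the whole line, to the ball of radius \<open>R\<close>. A solution of the linear problem is
  brought into this space by extending it beyond \<open>[0,1]\<close> by its boundary values;
  the extension does not increase the uniform norm or uniform distances.\<close>

lemma bvp_solution_exists_in_ball:
  assumes \<beta>: "\<beta> > 0" and L: "L \<ge> 0" "L / (2 * (\<beta> + 1)) < 1"
    and f: "continuous_on ({0..1} \<times> UNIV) (\<lambda>(x, u). f x u)"
    and bound: "\<And>x a. x \<in> {0..1} \<Longrightarrow> \<bar>a\<bar> \<le> R \<Longrightarrow> \<bar>f x a\<bar> \<le> M"
    and lip: "\<And>x a b. x \<in> {0..1} \<Longrightarrow> \<bar>a\<bar> \<le> R \<Longrightarrow> \<bar>b\<bar> \<le> R \<Longrightarrow> \<bar>f x b - f x a\<bar> \<le> L * \<bar>b - a\<bar>"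
    and R: "R = \<bar>\<alpha>\<bar> + M / (2 * (\<beta> + 1))" "R \<ge> 0"
  shows "\<exists>u w. linear_bvp \<alpha> \<beta> (\<lambda>x. f x (u x)) u w \<and> (\<forall>x\<in>{0..1}. \<bar>u x\<bar> \<le> R)"
proof -
  define c :: "real \<Rightarrow> real" where "c = (\<lambda>x. max 0 (min 1 x))"
  have c: "c x \<in> {0..1}" and c_id: "x \<in> {0..1} \<Longrightarrow> c x = x" for x
    by (auto simp: c_def)
  define B where "B = cball (0 :: real \<Rightarrow>\<^sub>C real) R"
  have B_iff: "\<phi> \<in> B \<longleftrightarrow> (\<forall>x. \<bar>apply_bcontfun \<phi> x\<bar> \<le> R)" for \<phi>
    unfolding B_def
    by (metis dist_0_norm mem_cball norm_bound norm_bounded order_trans real_norm_def)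
  have cont: "continuous_on {0..1} (\<lambda>x. f x (apply_bcontfun \<phi> x))" for \<phi> :: "real \<Rightarrow>\<^sub>C real"
  proof -
    have "continuous_on {0..1} (\<lambda>x. (x, apply_bcontfun \<phi> x))"
      using apply_bcontfun[of \<phi>]
      by (auto intro!: continuous_intros intro: continuous_on_subset simp: bcontfun_def)
    then show ?thesis
      using continuous_on_compose2[OF f] by fastforce
  qed
  have "\<exists>u w. linear_bvp \<alpha> \<beta> (\<lambda>x. f x (apply_bcontfun \<phi> x)) u w" for \<phi>
    using linear_bvp_exists[OF \<beta> cont] .
  then obtain U W
    where UW: "\<And>\<phi>. linear_bvp \<alpha> \<beta> (\<lambda>x. f x (apply_bcontfun \<phi> x)) (U \<phi>) (W \<phi>)"
    by metis
  have U_le: "\<bar>U \<phi> x\<bar> \<le> R" if "\<phi> \<in> B" "x \<in> {0..1}" for \<phi> x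
    using linear_bvp_value_bound'[OF \<beta> UW[of \<phi>] bound that(2)] that(1) R(1) B_iff by fastforce
  define T where "T = (\<lambda>\<phi>. Bcontfun (\<lambda>x. U \<phi> (c x)))"
  have T: "apply_bcontfun (T \<phi>) x = U \<phi> (c x)" for \<phi> x
  proof -
    have "continuous_on UNIV c" unfolding c_def by (intro continuous_intros)
    then have "continuous_on UNIV (\<lambda>x. U \<phi> (c x))"
      using continuous_on_compose2[OF linear_bvp_continuous[OF UW]] c by blast
    moreover have "bounded (range (\<lambda>x. U \<phi> (c x)))"
      using compact_imp_bounded[OF compact_continuous_image[OF linear_bvp_continuous[OF UW] compact_Icc]]
      by (rule bounded_subset) (use c in blast)
    ultimately have "(\<lambda>x. U \<phi> (c x)) \<in> bcontfun" by (simp add: bcontfun_def)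
    then show ?thesis by (simp add: T_def Bcontfun_inverse)
  qed
  have "\<exists>!\<phi>\<in>B. T \<phi> = \<phi>"
  proof (rule Banach_fix)
    show "complete B" by (simp add: B_def complete_eq_closed)
    show "B \<noteq> {}" using R(2) by (simp add: B_def)
    show "0 \<le> L / (2 * (\<beta> + 1))" using L \<beta> by simp
    show "T ` B \<subseteq> B" using U_le c B_iff T by fastforce
    show "dist (T \<phi>) (T \<psi>) \<le> L / (2 * (\<beta> + 1)) * dist \<phi> \<psi>" if "\<phi> \<in> B" "\<psi> \<in> B" for \<phi> \<psi>
    proof (rule dist_bound)
      fix x
      have rhs: "\<bar>f t (apply_bcontfun \<phi> t) - f t (apply_bcontfun \<psi> t)\<bar> \<le> L * dist \<phi> \<psi>"
        if t: "t \<in> {0..1}" for t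
      proof -
        have "\<bar>f t (apply_bcontfun \<phi> t) - f t (apply_bcontfun \<psi> t)\<bar>
              \<le> L * \<bar>apply_bcontfun \<phi> t - apply_bcontfun \<psi> t\<bar>"
          using lip[OF t] \<open>\<phi> \<in> B\<close> \<open>\<psi> \<in> B\<close> B_iff by blast
        also have "\<dots> \<le> L * dist \<phi> \<psi>"
          using dist_bounded[of \<phi> t \<psi>] L(1) by (simp add: dist_real_def mult_left_mono)
        finally show ?thesis .
      qed
      have "\<bar>(U \<phi> (c x) - U \<psi> (c x)) - (\<alpha> - \<alpha>)\<bar> \<le> L * dist \<phi> \<psi> / (2 * (\<beta> + 1))"
        by (rule linear_bvp_value_bound'[OF \<beta> linear_bvp_diff[OF UW UW] rhs c])
      then show "dist (apply_bcontfun (T \<phi>) x) (apply_bcontfun (T \<psi>) x)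
                 \<le> L / (2 * (\<beta> + 1)) * dist \<phi> \<psi>"
        by (simp add: T dist_real_def)
    qed
  qed (use L(2) in auto)
  then obtain \<phi> where \<phi>: "\<phi> \<in> B" "T \<phi> = \<phi>" by blast
  have fix_eq: "apply_bcontfun \<phi> x = U \<phi> x" if "x \<in> {0..1}" for x
    using T[of \<phi> x] \<phi>(2) c_id[OF that] by simp
  have "linear_bvp \<alpha> \<beta> (\<lambda>x. f x (U \<phi> x)) (U \<phi>) (W \<phi>)"
    using UW[of \<phi>] fix_eq unfolding linear_bvp_def by auto
  then show ?thesis using U_le[OF \<phi>(1)] by blast
qed

theorem theorem2p1:
  fixes \<alpha> \<beta> M L q :: real and f :: "real \<Rightarrow> real \<Rightarrow> real"
  assumes "\<beta> \<ge> 1"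
    and "continuous_on ({0..1} \<times> UNIV) (\<lambda>(x, u). f x u)"
    and "M > 0" and "L \<ge> 0"
    and "\<And>x u. (x, u) \<in> D_dom \<alpha> \<beta> M \<Longrightarrow> \<bar>f x u\<bar> \<le> M"
    and "\<And>x u1 u2. (x, u1) \<in> D_dom \<alpha> \<beta> M \<Longrightarrow> (x, u2) \<in> D_dom \<alpha> \<beta> M \<Longrightarrow>
           \<bar>f x u2 - f x u1\<bar> \<le> L * \<bar>u2 - u1\<bar>"
    and "q = L / (2 * (\<beta> + 1))" and "q < 1"
  shows "\<exists>u. bvp_solution \<alpha> \<beta> f u \<and>
           unorm u \<le> \<bar>\<alpha>\<bar> + M / (2 * (\<beta> + 1)) \<and>
           unorm (deriv01 u) \<le> M / (\<beta> + 1) \<and>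
           (\<forall>v. bvp_solution \<alpha> \<beta> f v \<and> unorm v \<le> \<bar>\<alpha>\<bar> + M / (2 * (\<beta> + 1)) \<longrightarrow>
                (\<forall>x\<in>{0..1}. v x = u x))"
proof -
  define R where "R = \<bar>\<alpha>\<bar> + M / (2 * (\<beta> + 1))"
  have \<beta>: "\<beta> > 0" and R0: "R \<ge> 0" and q: "L / (2 * (\<beta> + 1)) < 1"
    using assms by (auto simp: R_def)
  have bound: "\<bar>f x a\<bar> \<le> M" if "x \<in> {0..1}" "\<bar>a\<bar> \<le> R" for x a
    using assms(5)[of x a] that by (simp add: D_dom_def R_def)
  have lip: "\<bar>f x b - f x a\<bar> \<le> L * \<bar>b - a\<bar>" if "x \<in> {0..1}" "\<bar>a\<bar> \<le> R" "\<bar>b\<bar> \<le> R" for x a b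
    using assms(6)[of x a b] that by (simp add: D_dom_def R_def)
  obtain u w where u: "linear_bvp \<alpha> \<beta> (\<lambda>x. f x (u x)) u w"
    and uR: "\<And>x. x \<in> {0..1} \<Longrightarrow> \<bar>u x\<bar> \<le> R"
    using bvp_solution_exists_in_ball[OF \<beta> assms(4) q assms(2) bound lip R_def R0] by blast
  have "\<bar>deriv01 u x\<bar> \<le> M / (\<beta> + 1)" if x: "x \<in> {0..1}" for x
  proof -
    have "\<bar>w x\<bar> \<le> M * x / (\<beta> + 1)"
      by (rule linear_bvp_derivative_bound[OF \<beta> u bound x]) (use uR in auto)
    also have "\<dots> \<le> M / (\<beta> + 1)"
      using x \<beta> assms(3) by (simp add: divide_right_mono mult_left_le)
    finally show ?thesis using linear_bvp_deriv01[OF u x] by simp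
  qed
  moreover have "v x = u x" if v: "bvp_solution \<alpha> \<beta> f v" "unorm v \<le> R" and x: "x \<in> {0..1}" for v x
  proof (rule bvp_solution_unique_in_ball[OF \<beta> assms(4) q lip u uR _ _ x])
    show lin: "linear_bvp \<alpha> \<beta> (\<lambda>x. f x (v x)) v (deriv01 v)"
      using bvp_solution_imp_linear_bvp[OF v(1)] .
    show "\<bar>v t\<bar> \<le> R" if "t \<in> {0..1}" for t
      using abs_le_unorm[OF linear_bvp_continuous[OF lin] that] v(2) by linarith
  qed
  ultimately show ?thesis
    using linear_bvp_imp_bvp_solution[of \<alpha> \<beta> f u w, OF u] unorm_le[of u R] uR unorm_le[of "deriv01 u"]
    unfolding R_def by blast
qed

end
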